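(* Let $\mathbf K$ be a field, let $\mathbf A=\mathbf K[f_1,\ldots,f_s]\subseteq\mathbf K[t]$ be such that $\mathbf K[t]/\mathbf A$ has finite length as an $\mathbf A$-module and $\{f_1,\ldots,f_s\}$ is a reduced basis of $\mathbf A$, and let $\mathbf M=\sum_{i=1}^rF_i\mathbf A$ with $F_1,\ldots,F_r\in\mathbf K[t]$ monic, $r\geq 1$. Consider the following procedure, applied to $\{F_1,\ldots,F_r\}$: (1) if $\mathrm R_{\mathbf A}(F,\{F_1,\ldots,F_r\})=0$ for all $F\in\mathrm{MinSP}(F_1,\ldots,F_r)$, return $\{F_1,\ldots,F_r\}$; (2) if $\mathrm R_{\mathbf A}(F,\{F_1,\ldots,F_r\})\neq0$ for some $F\in\mathrm{MinSP}(F_1,\ldots,F_r)$, let $F_{r+1}$ be $\mathrm R_{\mathbf A}(F,\{F_1,\ldots,F_r\})$ divided by its leading coefficient, and restart with $\{F_1,\ldots,F_{r+1}\}$. Then this procedure stops after a finite number of steps, and it returns a basis of $\mathbf M$.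
   Context: For a nonzero $f=\sum_i c_it^i\in\mathbf K[t]$ of degree $p$, write $\mathrm d(f)=p$, $\mathrm M(f)=c_pt^p$ (leading monomial) and $\mathrm{supp}(f)=\{i\mid c_i\neq 0\}$; $\mathrm{supp}(0)=\emptyset$. Put $\mathrm d(\mathbf A)=\{\mathrm d(f)\mid f\in\mathbf A\setminus\{0\}\}$ and $\mathrm d(\mathbf M)=\{\mathrm d(F)\mid F\in\mathbf M\setminus\{0\}\}$. The finite length assumption implies that $S=\mathrm d(\mathbf A)$ is a numerical semigroup (a submonoid of $\mathbb N$ with finite complement). The set $\{f_1,\ldots,f_s\}$ is a basis of $\mathbf A$ if $\mathrm d(f_1),\ldots,\mathrm d(f_s)$ generate the monoid $\mathrm d(\mathbf A)$; it is a reduced basis if moreover every $f_i$ is monic and $\mathrm{supp}(f_i-\mathrm M(f_i))\subseteq\mathbb N\setminus\mathrm d(\mathbf A)$ for all $i$. A finite set $\{G_1,\ldots,G_q\}$ of nonzero elements generating the $\mathbf A$-module $\mathbf M$ is a basis of $\mathbf M$ if $\mathrm d(\mathbf M)=\bigcup_{i=1}^q(\mathrm d(G_i)+\mathrm d(\mathbf A))$. Remainders: for every nonzero $F\in\mathbf K[t]$ there exist $g_1,\ldots,g_r\in\mathbf A$ and $R\in\mathbf K[t]$ with $F=\sum_i g_iF_i+R$; $\mathrm d(g_i)+\mathrm d(F_i)\le\mathrm d(F)$ whenever $g_i\ne0$; and, if $R\neq0$, $\mathrm d(R)\le \mathrm d(F)$ and $\mathrm d(R)\in\mathbb N\setminus\bigcup_{i=1}^r(\mathrm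 d(F_i)+\mathrm d(\mathbf A))$. For each $F\ne 0$ an (arbitrary) such $R$ is chosen and denoted $\mathrm R_{\mathbf A}(F,\{F_1,\ldots,F_r\})$; also $\mathrm R_{\mathbf A}(0,\{F_1,\ldots,F_r\})=0$. Order on $\mathbb Z$: $n_1\le_S n_2$ iff $n_2-n_1\in S$. For $a,b\in\mathbb N$, let $\{c_1,\ldots,c_q\}$ be the (finite) set of minimal elements of $(a+S)\cap(b+S)$ with respect to $\le_S$, and set $\mathrm R(a,b)=\{(c_k-a,c_k-b)\mid k=1,\ldots,q\}$; its components lie in $S$. Minimal $S$-polynomials: for $n\in S$ let $\mathsf Z(n)=\{(n_1,\ldots,n_s)\in\mathbb N^s\mid n=\sum_{l=1}^s n_l\,\mathrm d(f_l)\}$, let $e(n)=(e_1(n),\ldots,e_s(n))$ be its minimum for the lexicographical order on $\mathbb N^s$, and put $f^{e(n)}=\prod_{l=1}^s f_l^{e_l(n)}$, a monic element of $\mathbf A$ of degree $n$. With $a_i=\mathrm d(F_i)$, $\mathrm{MinSP}(F_1,\ldots,F_r)$ is the set of all polynomials $f^{e(s_i)}F_i-f^{e(s_j)}F_j$ with $i,j\in\{1,\ldots,r\}$, $i\neq j$, and $(s_i,s_j)\in\mathrm R(a_i,a_j)$. The same notation is used for the enlarged sets of polynomials. *)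

theory Defs
  imports "HOL-Computational_Algebra.Polynomial"
begin

inductive_set subalgebra_gen :: "'a::field poly set \<Rightarrow> 'a poly set" for X where
  const: "[:c:] \<in> subalgebra_gen X"
| gen: "f \<in> X \<Longrightarrow> f \<in> subalgebra_gen X"
| add: "p \<in> subalgebra_gen X \<Longrightarrow> q \<in> subalgebra_gen X \<Longrightarrow> p + q \<in> subalgebra_gen X"
| mult: "p \<in> subalgebra_gen X \<Longrightarrow> q \<in> subalgebra_gen X \<Longrightarrow> p * q \<in> subalgebra_gen X"

definition module_gen :: "'a::field poly set \<Rightarrow> 'a poly set \<Rightarrow> 'a poly set" where
  "module_gen A B = {\<Sum>G\<in>B. g G * G | g. \<forall>G\<in>B. g G \<in> A}"

definition supp :: "'a::field poly \<Rightarrow> nat set" where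
  "supp f = {i. coeff f i \<noteq> 0}"

definition lead_monom :: "'a::field poly \<Rightarrow> 'a poly" where
  "lead_monom f = monom (lead_coeff f) (degree f)"

definition degs :: "'a::field poly set \<Rightarrow> nat set" where
  "degs X = degree ` (X - {0})"

text \<open>The quotient \<open>K[t]/A\<close> consists of the cosets \<open>p + A\<close>, with the operations
  \<open>(p + A) + (q + A) = (p + q) + A\<close> and \<open>a \<cdot> (p + A) = a p + A\<close> for \<open>a \<in> A\<close>.
  Its length is the supremum of the lengths of strict chains of submodules.\<close>

definition coset :: "'a::field poly set \<Rightarrow> 'a poly \<Rightarrow> 'a poly set" where
  "coset A p = (+) p ` A"

definition quotient_submodule :: "'a::field poly set \<Rightarrow> 'a poly set set \<Rightarrow> bool" where
  "quotient_submodule A L \<longleftrightarrow>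
     L \<subseteq> range (coset A) \<and> coset A 0 \<in> L \<and>
     (\<forall>p q. coset A p \<in> L \<longrightarrow> coset A q \<in> L \<longrightarrow> coset A (p + q) \<in> L) \<and>
     (\<forall>a\<in>A. \<forall>p. coset A p \<in> L \<longrightarrow> coset A (a * p) \<in> L)"

definition quotient_finite_length :: "'a::field poly set \<Rightarrow> bool" where
  "quotient_finite_length A \<longleftrightarrow>
     (\<exists>N. \<forall>(L :: nat \<Rightarrow> 'a poly set set) m.
        (\<forall>i\<le>m. quotient_submodule A (L i)) \<and> (\<forall>i<m. L i \<subset> L (Suc i)) \<longrightarrow> m \<le> N)"

inductive_set submonoid_gen :: "nat set \<Rightarrow> nat set" for X where
  zero: "0 \<in> submonoid_gen X"
| gen: "n \<in> X \<Longrightarrow> n \<in> submonoid_gen X"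
| add: "m \<in> submonoid_gen X \<Longrightarrow> n \<in> submonoid_gen X \<Longrightarrow> m + n \<in> submonoid_gen X"

definition algebra_basis :: "'a::field poly set \<Rightarrow> 'a poly list \<Rightarrow> bool" where
  "algebra_basis A fs \<longleftrightarrow>
     set fs \<subseteq> A - {0} \<and> submonoid_gen (degree ` set fs) = degs A"

definition reduced_basis :: "'a::field poly set \<Rightarrow> 'a poly list \<Rightarrow> bool" where
  "reduced_basis A fs \<longleftrightarrow> algebra_basis A fs \<and>
     (\<forall>f\<in>set fs. lead_coeff f = 1 \<and> supp (f - lead_monom f) \<subseteq> - degs A)"

definition module_basis :: "'a::field poly set \<Rightarrow> 'a poly set \<Rightarrow> 'a poly set \<Rightarrow> bool" where
  "module_basis A M B \<longleftrightarrow> finite B \<and> 0 \<notin> B \<and> module_gen A B = M \<and>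
     degs M = (\<Union>G\<in>B. (+) (degree G) ` degs A)"

definition is_remainder ::
    "'a::field poly set \<Rightarrow> 'a poly \<Rightarrow> 'a poly set \<Rightarrow> 'a poly \<Rightarrow> bool" where
  "is_remainder A F B R \<longleftrightarrow>
     (\<exists>g. (\<forall>G\<in>B. g G \<in> A) \<and> F = (\<Sum>G\<in>B. g G * G) + R \<and>
          (\<forall>G\<in>B. g G \<noteq> 0 \<longrightarrow> degree (g G) + degree G \<le> degree F)) \<and>
     (R \<noteq> 0 \<longrightarrow> degree R \<le> degree F \<and> degree R \<notin> (\<Union>G\<in>B. (+) (degree G) ` degs A))"

text \<open>Remainders are not unique: \<open>rem\<close> below is any function selecting one of them.\<close>

definition remainder_choice ::
    "'a::field poly set \<Rightarrow> ('a poly \<Rightarrow> 'a poly set \<Rightarrow> 'a poly) \<Rightarrow> bool" where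
  "remainder_choice A rem \<longleftrightarrow>
     (\<forall>B. finite B \<and> B \<noteq> {} \<and> (\<forall>G\<in>B. lead_coeff G = 1) \<longrightarrow>
        rem 0 B = 0 \<and> (\<forall>F. F \<noteq> 0 \<longrightarrow> is_remainder A F B (rem F B)))"

lemma exists_remainder:
  assumes A: "A = subalgebra_gen X" and B: "finite B" "\<forall>G\<in>B. lead_coeff G = 1"
  shows "F \<noteq> 0 \<Longrightarrow> \<exists>R. is_remainder A F B R"
proof (induction "degree F" arbitrary: F rule: less_induct)
  case less
  have z: "0 \<in> A" using subalgebra_gen.const[of 0] A by simp
  show ?case
  proof (cases "degree F \<in> (\<Union>G\<in>B. (+) (degree G) ` degs A)")
    case False
    have "is_remainder A F B F" unfolding is_remainder_def
      using False z by (intro conjI exI[of _ "\<lambda>_. 0"]) auto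
    then show ?thesis by blast
  next
    case True
    then obtain G a where G: "G \<in> B" "a \<in> A" "a \<noteq> 0" "degree F = degree G + degree a"
      by (auto simp: degs_def)
    define b where "b = [:lead_coeff F / lead_coeff a:] * a"
    have bA: "b \<in> A" unfolding b_def A
      by (rule subalgebra_gen.mult[OF subalgebra_gen.const]) (use G A in simp)
    have db: "degree b = degree a" and lb: "lead_coeff b = lead_coeff F" and b0: "b \<noteq> 0"
    proof -
      have "lead_coeff F \<noteq> 0" "lead_coeff a \<noteq> 0"
        using less.prems G(3) by (simp_all only: leading_coeff_0_iff not_False_eq_True)
      then show "degree b = degree a" "lead_coeff b = lead_coeff F" "b \<noteq> 0"
        using G(3) by (simp_all add: b_def del: leading_coeff_0_iff)
    qed
    have G0: "G \<noteq> 0" "lead_coeff G = 1" using B G(1) by auto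
    have dbG: "degree (b * G) = degree F" using degree_mult_eq[OF b0 G0(1)] db G by simp
    have lbG: "lead_coeff (b * G) = lead_coeff F" using lb G0 by (simp only: lead_coeff_mult mult_1_right)
    define H where "H = F - b * G"
    have F: "F = b * G + H" by (simp add: H_def)
    show ?thesis
    proof (cases "H = 0")
      case True
      have "(\<Sum>G'\<in>B. (if G' = G then b else 0) * G') = (\<Sum>G'\<in>B. (if G' = G then b * G else 0))"
        by (rule sum.cong) auto
      then have "is_remainder A F B 0" unfolding is_remainder_def
        using z bA G db F True B
        by (intro conjI exI[of _ "\<lambda>G'. if G' = G then b else 0"]) auto
      then show ?thesis by blast
    next
      case False
      have "coeff H (degree F) = 0" using dbG lbG by (simp add: H_def)
      moreover have "degree H \<le> degree F" using dbG by (simp add: H_def degree_diff_le)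
      ultimately have d: "degree H < degree F"
        using False by (metis le_neq_implies_less leading_coeff_0_iff)
      from less.hyps[OF d False] obtain R where "is_remainder A H B R" by blast
      then obtain g where g: "\<forall>G\<in>B. g G \<in> A" "H = (\<Sum>G\<in>B. g G * G) + R"
        "\<forall>G\<in>B. g G \<noteq> 0 \<longrightarrow> degree (g G) + degree G \<le> degree H"
        and R: "R \<noteq> 0 \<longrightarrow> degree R \<le> degree H \<and> degree R \<notin> (\<Union>G\<in>B. (+) (degree G) ` degs A)"
        unfolding is_remainder_def by blast
      let ?g = "\<lambda>G'. if G' = G then g G + b else g G'"
      have "(\<Sum>G'\<in>B. ?g G' * G') = (\<Sum>G'\<in>B. g G' * G' + (if G' = G then b * G else 0))"
        by (rule sum.cong) (auto simp: algebra_simps)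
      also have "\<dots> = (\<Sum>G'\<in>B. g G' * G') + b * G" using B G by (simp add: sum.distrib)
      finally have 1: "F = (\<Sum>G'\<in>B. ?g G' * G') + R" using F g(2) by simp
      have 2: "\<forall>G'\<in>B. ?g G' \<in> A" using g(1) bA G A by (auto intro: subalgebra_gen.add)
      have gG: "degree (g G) + degree G \<le> degree F"
        using g(3) G d by (cases "g G = 0") auto
      have "degree (g G + b) + degree G \<le> degree F"
        using degree_add_le_max[of "g G" b] gG G(4) db by linarith
      then have 3: "\<forall>G'\<in>B. ?g G' \<noteq> 0 \<longrightarrow> degree (?g G') + degree G' \<le> degree F"
        using g(3) d by auto
      have "is_remainder A F B R" unfolding is_remainder_def
        using 1 2 3 R d by (intro conjI exI[of _ ?g]) auto
      then show ?thesis by blast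
    qed
  qed
qed

lemma exists_remainder_choice: "\<exists>rem. remainder_choice (subalgebra_gen X) rem"
proof (rule exI)
  show "remainder_choice (subalgebra_gen X)
     (\<lambda>F B. if F = 0 then 0 else SOME R. is_remainder (subalgebra_gen X) F B R)"
    unfolding remainder_choice_def
    using someI_ex[OF exists_remainder[OF refl]] by auto
qed

definition le_semigroup :: "nat set \<Rightarrow> int \<Rightarrow> int \<Rightarrow> bool" where
  "le_semigroup S n1 n2 \<longleftrightarrow> n2 - n1 \<in> int ` S"

definition min_common :: "nat set \<Rightarrow> nat \<Rightarrow> nat \<Rightarrow> nat set" where
  "min_common S a b =
     {c \<in> (+) a ` S \<inter> (+) b ` S.
        \<forall>c' \<in> (+) a ` S \<inter> (+) b ` S. le_semigroup S (int c') (int c) \<longrightarrow> c' = c}"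

text \<open>The natural number subtractions do not truncate, since \<open>c \<in> (a + S) \<inter> (b + S)\<close>.\<close>

definition R_set :: "nat set \<Rightarrow> nat \<Rightarrow> nat \<Rightarrow> (nat \<times> nat) set" where
  "R_set S a b = {(c - a, c - b) | c. c \<in> min_common S a b}"

definition factorizations :: "'a::field poly list \<Rightarrow> nat \<Rightarrow> nat list set" where
  "factorizations fs n =
     {u. length u = length fs \<and> n = (\<Sum>l<length fs. u ! l * degree (fs ! l))}"

definition lex_min :: "'a::field poly list \<Rightarrow> nat \<Rightarrow> nat list" where
  "lex_min fs n =
     (THE u. u \<in> factorizations fs n \<and>
             (\<forall>v\<in>factorizations fs n. u = v \<or> (u, v) \<in> lex less_than))"

definition lex_power :: "'a::field poly list \<Rightarrow> nat \<Rightarrow> 'a poly" where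
  "lex_power fs n = (\<Prod>l<length fs. (fs ! l) ^ (lex_min fs n ! l))"

definition MinSP :: "'a::field poly list \<Rightarrow> 'a poly list \<Rightarrow> 'a poly set" where
  "MinSP fs Fs =
     {lex_power fs m * Fs ! i - lex_power fs n * Fs ! j | i j m n.
        i < length Fs \<and> j < length Fs \<and> i \<noteq> j \<and>
        (m, n) \<in> R_set (degs (subalgebra_gen (set fs))) (degree (Fs ! i)) (degree (Fs ! j))}"

inductive procedure_step ::
    "('a::field poly \<Rightarrow> 'a poly set \<Rightarrow> 'a poly) \<Rightarrow> 'a poly list \<Rightarrow>
     'a poly list \<Rightarrow> 'a poly list \<Rightarrow> bool" for rem fs where
  "F \<in> MinSP fs Fs \<Longrightarrow> rem F (set Fs) \<noteq> 0 \<Longrightarrow>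
   procedure_step rem fs Fs
     (Fs @ [smult (inverse (lead_coeff (rem F (set Fs)))) (rem F (set Fs))])"

definition procedure_returns ::
    "('a::field poly \<Rightarrow> 'a poly set \<Rightarrow> 'a poly) \<Rightarrow> 'a poly list \<Rightarrow> 'a poly list \<Rightarrow> bool" where
  "procedure_returns rem fs Fs \<longleftrightarrow> (\<forall>F\<in>MinSP fs Fs. rem F (set Fs) = 0)"

end

theory Submission
  imports Defs
begin

text \<open>Each step adds a polynomial whose degree lies outside the union of the sets
  \<open>d(F\<^sub>i) + S\<close>.  Fix a positive \<open>s \<in> S\<close>: infinitely many of these degrees would be congruent modulo
  \<open>s\<close>, and along them the degree would have to decrease strictly.  Hence the procedure stops.

  For the basis property take a representation \<open>H = \<Sum> g\<^sub>i F\<^sub>i\<close> whose terms have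
  degree at most \<open>D\<close>.  If \<open>D\<close> exceeds the degree of \<open>H\<close>, at least two terms have degree exactly
  \<open>D\<close>; a multiple of their minimal S-polynomial, which has a representation with terms
  of smaller degree, eliminates one of them.  Induction on \<open>D\<close> and on the number of terms of degree \<open>D\<close>
  reduces to the case where \<open>D\<close> is the degree of \<open>H\<close>.\<close>

section \<open>Subalgebras and submodules\<close>

lemma zero_in_subalgebra_gen: "0 \<in> subalgebra_gen X"
  using subalgebra_gen.const[of 0 X] by simp

lemma one_in_subalgebra_gen: "1 \<in> subalgebra_gen X"
  using subalgebra_gen.const[of 1 X] by (simp add: one_pCons)

lemma smult_in_subalgebra_gen:
  assumes "p \<in> subalgebra_gen X"
  shows "smult c p \<in> subalgebra_gen X"
  using subalgebra_gen.mult[OF subalgebra_gen.const[of c] assms] by simp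

lemma diff_in_subalgebra_gen:
  assumes "p \<in> subalgebra_gen X" "q \<in> subalgebra_gen X"
  shows "p - q \<in> subalgebra_gen X"
  using subalgebra_gen.add[OF assms(1) smult_in_subalgebra_gen[OF assms(2), of "-1"]] by simp

lemma power_in_subalgebra_gen:
  assumes "p \<in> subalgebra_gen X"
  shows "p ^ n \<in> subalgebra_gen X"
  by (induction n) (auto intro: one_in_subalgebra_gen subalgebra_gen.mult assms)

lemma prod_in_subalgebra_gen:
  assumes "\<And>i. i \<in> I \<Longrightarrow> f i \<in> subalgebra_gen X"
  shows "prod f I \<in> subalgebra_gen X"
  using assms
  by (induction I rule: infinite_finite_induct)
    (auto intro: one_in_subalgebra_gen subalgebra_gen.mult)

lemma zero_in_degs: "0 \<in> degs (subalgebra_gen X)"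
  using one_in_subalgebra_gen by (force simp: degs_def)

lemma add_in_degs:
  assumes "m \<in> degs (subalgebra_gen X)" "n \<in> degs (subalgebra_gen X)"
  shows "m + n \<in> degs (subalgebra_gen X)"
proof -
  obtain p q where "p \<in> subalgebra_gen X" "p \<noteq> 0" "degree p = m"
    "q \<in> subalgebra_gen X" "q \<noteq> 0" "degree q = n"
    using assms by (auto simp: degs_def)
  then show ?thesis
    unfolding degs_def
    by (intro image_eqI[of _ _ "p * q"]) (auto simp: degree_mult_eq intro: subalgebra_gen.mult)
qed

lemma mult_in_degs:
  assumes "n \<in> degs (subalgebra_gen X)"
  shows "k * n \<in> degs (subalgebra_gen X)"
  by (induction k) (auto intro: zero_in_degs add_in_degs assms)

lemma monic_of_degree:
  assumes "n \<in> degs (subalgebra_gen X)"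
  obtains p where "p \<in> subalgebra_gen X" "lead_coeff p = 1" "degree p = n"
proof -
  obtain q where q: "q \<in> subalgebra_gen X" "q \<noteq> 0" "degree q = n"
    using assms by (auto simp: degs_def)
  show thesis
    by (rule that[of "smult (inverse (lead_coeff q)) q"])
      (use q in \<open>auto intro: smult_in_subalgebra_gen\<close>)
qed

section \<open>Submodules of the polynomial ring generated by a set\<close>

lemma zero_in_module_gen: "0 \<in> module_gen (subalgebra_gen X) B"
  unfolding module_gen_def using zero_in_subalgebra_gen[of X]
  by (auto intro!: exI[of _ "\<lambda>_. 0"])

lemma add_in_module_gen:
  assumes "p \<in> module_gen (subalgebra_gen X) B" "q \<in> module_gen (subalgebra_gen X) B"
  shows "p + q \<in> module_gen (subalgebra_gen X) B"
proof -
  obtain g h where "\<forall>G\<in>B. g G \<in> subalgebra_gen X" "p = (\<Sum>G\<in>B. g G * G)"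
    "\<forall>G\<in>B. h G \<in> subalgebra_gen X" "q = (\<Sum>G\<in>B. h G * G)"
    using assms by (auto simp: module_gen_def)
  then show ?thesis
    unfolding module_gen_def
    by (intro CollectI exI[of _ "\<lambda>G. g G + h G"])
      (auto simp: sum.distrib algebra_simps intro: subalgebra_gen.add)
qed

lemma mult_in_module_gen:
  assumes "a \<in> subalgebra_gen X" "p \<in> module_gen (subalgebra_gen X) B"
  shows "a * p \<in> module_gen (subalgebra_gen X) B"
proof -
  obtain g where "\<forall>G\<in>B. g G \<in> subalgebra_gen X" "p = (\<Sum>G\<in>B. g G * G)"
    using assms by (auto simp: module_gen_def)
  then show ?thesis
    unfolding module_gen_def using assms(1)
    by (intro CollectI exI[of _ "\<lambda>G. a * g G"])
      (auto simp: sum_distrib_left mult.assoc intro: subalgebra_gen.mult)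
qed

lemma diff_in_module_gen:
  assumes "p \<in> module_gen (subalgebra_gen X) B" "q \<in> module_gen (subalgebra_gen X) B"
  shows "p - q \<in> module_gen (subalgebra_gen X) B"
  using add_in_module_gen[OF assms(1) mult_in_module_gen[OF subalgebra_gen.const[of "-1"] assms(2)]]
  by simp

lemma generator_in_module_gen:
  assumes "finite B" "G \<in> B"
  shows "G \<in> module_gen (subalgebra_gen X) B"
proof -
  have "(\<Sum>H\<in>B. (if H = G then 1 else 0) * H) = (\<Sum>H\<in>B. if H = G then G else 0)"
    by (rule sum.cong) auto
  then have "G = (\<Sum>H\<in>B. (if H = G then 1 else 0) * H)"
    using assms by simp
  then show ?thesis
    unfolding module_gen_def
    by (intro CollectI exI[of _ "\<lambda>H. if H = G then 1 else 0"])
      (auto intro: one_in_subalgebra_gen zero_in_subalgebra_gen)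
qed

lemma module_gen_subset:
  assumes "B \<subseteq> module_gen (subalgebra_gen X) C"
  shows "module_gen (subalgebra_gen X) B \<subseteq> module_gen (subalgebra_gen X) C"
proof
  fix p assume "p \<in> module_gen (subalgebra_gen X) B"
  then obtain g where g: "\<forall>G\<in>B. g G \<in> subalgebra_gen X" and p: "p = (\<Sum>G\<in>B. g G * G)"
    by (auto simp: module_gen_def)
  \<comment> \<open>For infinite \<open>B\<close> the sum is 0 by convention, and 0 also lies in the
    target.\<close>
  have "(\<Sum>G\<in>B. g G * G) \<in> module_gen (subalgebra_gen X) C"
    using g assms
    by (induction B rule: infinite_finite_induct)
      (auto intro: zero_in_module_gen add_in_module_gen mult_in_module_gen)
  then show "p \<in> module_gen (subalgebra_gen X) C"
    using p by simp
qed

text \<open>Applied to a normalised remainder, this says that a step of the procedure leaves the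
  module unchanged.\<close>

lemma module_gen_insert:
  assumes "finite B" "G \<in> module_gen (subalgebra_gen X) B"
  shows "module_gen (subalgebra_gen X) (insert G B) = module_gen (subalgebra_gen X) B"
  using assms
  by (intro equalityI module_gen_subset) (auto intro: generator_in_module_gen)

lemma remainder_in_module_gen:
  assumes "is_remainder (subalgebra_gen X) F B R" "F \<in> module_gen (subalgebra_gen X) B"
  shows "R \<in> module_gen (subalgebra_gen X) B"
proof -
  obtain g where g: "\<forall>G\<in>B. g G \<in> subalgebra_gen X" "F = (\<Sum>G\<in>B. g G * G) + R"
    using assms(1) unfolding is_remainder_def by blast
  have "(\<Sum>G\<in>B. g G * G) \<in> module_gen (subalgebra_gen X) B"
    using g(1) by (auto simp: module_gen_def)
  from diff_in_module_gen[OF assms(2) this] show ?thesis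
    using g(2) by simp
qed

section \<open>Cosets and the finite length condition\<close>

lemma coset_eq_iff: "coset (subalgebra_gen X) p = coset (subalgebra_gen X) q \<longleftrightarrow>
    p - q \<in> subalgebra_gen X"
proof
  assume "coset (subalgebra_gen X) p = coset (subalgebra_gen X) q"
  moreover have "p \<in> coset (subalgebra_gen X) p"
    using zero_in_subalgebra_gen by (force simp: coset_def)
  ultimately have "p \<in> coset (subalgebra_gen X) q"
    by simp
  then show "p - q \<in> subalgebra_gen X"
    by (auto simp: coset_def)
next
  assume d: "p - q \<in> subalgebra_gen X"
  show "coset (subalgebra_gen X) p = coset (subalgebra_gen X) q"
  proof (intro equalityI subsetI)
    fix x assume "x \<in> coset (subalgebra_gen X) p"
    then obtain a where "x = p + a" "a \<in> subalgebra_gen X"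
      by (auto simp: coset_def)
    then show "x \<in> coset (subalgebra_gen X) q"
      using subalgebra_gen.add[OF d] unfolding coset_def
      by (intro image_eqI[of _ _ "p - q + a"]) auto
  next
    fix x assume "x \<in> coset (subalgebra_gen X) q"
    then obtain a where "x = q + a" "a \<in> subalgebra_gen X"
      by (auto simp: coset_def)
    then show "x \<in> coset (subalgebra_gen X) p"
      using diff_in_subalgebra_gen[OF _ d] unfolding coset_def
      by (intro image_eqI[of _ _ "a - (p - q)"]) auto
  qed
qed

text \<open>If \<open>A\<close> consisted of constants only, the polynomials of degree at most \<open>i\<close> would give an
  infinite strictly increasing chain of submodules.\<close>

lemma finite_length_imp_positive_degree:
  assumes fl: "quotient_finite_length (subalgebra_gen X)"
  shows "\<exists>s\<in>degs (subalgebra_gen X). s > 0"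
proof (rule ccontr)
  let ?A = "subalgebra_gen X"
  assume no: "\<not> ?thesis"
  have dA: "degree a = 0" if "a \<in> ?A" for a
    using no that by (cases "a = 0") (auto simp: degs_def)
  define L where "L i = coset ?A ` {p. degree p \<le> i}" for i :: nat
  \<comment> \<open>Representatives of one coset differ by a constant here, so the bound
    \<open>i\<close> on the degree does not depend on the representative.\<close>
  have L_iff: "coset ?A p \<in> L i \<longleftrightarrow> degree p \<le> i" for p i
  proof
    assume "coset ?A p \<in> L i"
    then obtain q where "degree q \<le> i" "p - q \<in> ?A"
      by (auto simp: L_def coset_eq_iff)
    then show "degree p \<le> i"
      using degree_add_le[of "p - q" i q] dA[of "p - q"] by simp
  qed (auto simp: L_def)
  have "quotient_submodule ?A (L i)" for i
    unfolding quotient_submodule_def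
  proof (intro conjI allI ballI impI)
    show "L i \<subseteq> range (coset ?A)"
      by (auto simp: L_def)
    show "coset ?A (a * p) \<in> L i" if "a \<in> ?A" "coset ?A p \<in> L i" for a p
      using that degree_mult_le[of a p] dA[of a] by (simp add: L_iff)
  qed (auto simp: L_iff degree_add_le)
  moreover have "L i \<subset> L (Suc i)" for i
  proof
    show "L i \<subseteq> L (Suc i)"
      by (auto simp: L_def)
    have "coset ?A (monom 1 (Suc i)) \<in> L (Suc i)" "coset ?A (monom 1 (Suc i)) \<notin> L i"
      by (simp_all add: L_iff degree_monom_eq)
    then show "L i \<noteq> L (Suc i)"
      by blast
  qed
  moreover obtain N where "\<And>(L :: nat \<Rightarrow> 'a poly set set) m.
      (\<forall>i\<le>m. quotient_submodule ?A (L i)) \<and> (\<forall>i<m. L i \<subset> L (Suc i)) \<Longrightarrow> m \<le> N"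
    using fl unfolding quotient_finite_length_def by blast
  ultimately have "Suc N \<le> N"
    by blast
  then show False
    by simp
qed

section \<open>Minimal S-polynomials\<close>

text \<open>The zero vector factorizes 0, a unit vector factorizes a generator, and componentwise
  sums of exponent vectors factorize sums.\<close>

lemma factorizations_nonempty:
  assumes "n \<in> submonoid_gen (degree ` set fs)"
  shows "factorizations fs n \<noteq> {}"
  using assms
proof (induction rule: submonoid_gen.induct)
  case zero
  have "replicate (length fs) 0 \<in> factorizations fs 0"
    by (simp add: factorizations_def)
  then show ?case by blast
next
  case (gen n)
  then obtain i where i: "i < length fs" "n = degree (fs ! i)"
    by (auto simp: in_set_conv_nth)
  have "(\<Sum>l<length fs. map (\<lambda>l. if l = i then 1 else 0) [0..<length fs] ! l * degree (fs ! l))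
      = (\<Sum>l<length fs. if l = i then degree (fs ! l) else 0)"
    by (rule sum.cong) auto
  then have "map (\<lambda>l. if l = i then 1 else 0) [0..<length fs] \<in> factorizations fs n"
    using i by (simp add: factorizations_def)
  then show ?case by blast
next
  case (add m n)
  then obtain u v where uv: "u \<in> factorizations fs m" "v \<in> factorizations fs n"
    by blast
  have "(\<Sum>l<length fs. map (\<lambda>l. u ! l + v ! l) [0..<length fs] ! l * degree (fs ! l))
      = (\<Sum>l<length fs. u ! l * degree (fs ! l) + v ! l * degree (fs ! l))"
    by (rule sum.cong) (auto simp: algebra_simps)
  then have "map (\<lambda>l. u ! l + v ! l) [0..<length fs] \<in> factorizations fs (m + n)"
    using uv by (simp add: factorizations_def sum.distrib)
  then show ?case by blast
qed

text \<open>The relation \<open>lex\<close> compares only lists of equal length, so totality is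
  claimed for those. It turns minimal factorizations into least ones.\<close>

lemma lex_less_than_total:
  fixes u v :: "nat list"
  assumes "length u = length v"
  shows "u = v \<or> (u, v) \<in> lex less_than \<or> (v, u) \<in> lex less_than"
  using assms by (induction u v rule: list_induct2) auto

text \<open>The description operator in \<open>lex_min\<close> needs a unique least element.
  Well-foundedness of \<open>lex less_than\<close> gives a minimal one, totality makes it least, and
  another least element would have to lie strictly below it.\<close>

lemma lex_min_in_factorizations:
  assumes "factorizations fs n \<noteq> {}"
  shows "lex_min fs n \<in> factorizations fs n"
proof -
  let ?P = "\<lambda>u. u \<in> factorizations fs n \<and>
      (\<forall>v\<in>factorizations fs n. u = v \<or> (u, v) \<in> lex less_than)"
  have wf: "wf (lex less_than :: (nat list \<times> nat list) set)"
    by (rule wf_lex) simp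
  obtain u where u: "u \<in> factorizations fs n"
    "\<And>v. (v, u) \<in> lex less_than \<Longrightarrow> v \<notin> factorizations fs n"
    using wfE_min[OF wf] assms by (metis ex_in_conv)
  have len: "length v = length fs" if "v \<in> factorizations fs n" for v
    using that by (simp add: factorizations_def)
  have Pu: "?P u"
    using u lex_less_than_total len by metis
  have "?P (lex_min fs n)"
    unfolding lex_min_def
  proof (rule theI[of ?P, OF Pu])
    fix v assume "?P v"
    then show "v = u"
      using u Pu by blast
  qed
  then show ?thesis by blast
qed

lemma lex_power_in_subalgebra_gen: "lex_power fs n \<in> subalgebra_gen (set fs)"
  unfolding lex_power_def
  by (intro prod_in_subalgebra_gen power_in_subalgebra_gen subalgebra_gen.gen) auto

lemma lead_coeff_lex_power:
  assumes "\<forall>f\<in>set fs. lead_coeff f = 1"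
  shows "lead_coeff (lex_power fs n) = 1"
  unfolding lex_power_def lead_coeff_prod lead_coeff_power
  using assms by (intro prod.neutral) auto

lemma degree_lex_power:
  assumes "\<forall>f\<in>set fs. lead_coeff f = 1" "n \<in> submonoid_gen (degree ` set fs)"
  shows "degree (lex_power fs n) = n"
proof -
  have nz: "fs ! l \<noteq> 0" if "l < length fs" for l
    using assms(1) nth_mem[OF that] by fastforce
  have "degree (lex_power fs n) = (\<Sum>l<length fs. degree ((fs ! l) ^ (lex_min fs n ! l)))"
    unfolding lex_power_def using nz by (intro degree_prod_eq_sum_degree) auto
  also have "\<dots> = (\<Sum>l<length fs. lex_min fs n ! l * degree (fs ! l))"
    using nz by (intro sum.cong) (auto simp: degree_power_eq)
  also have "\<dots> = n"
    using lex_min_in_factorizations[OF factorizations_nonempty[OF assms(2)]]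
    by (simp add: factorizations_def)
  finally show ?thesis .
qed

lemma MinSP_in_module_gen:
  assumes "F \<in> MinSP fs Fs"
  shows "F \<in> module_gen (subalgebra_gen (set fs)) (set Fs)"
proof -
  obtain i j m n where "i < length Fs" "j < length Fs"
    and F: "F = lex_power fs m * Fs ! i - lex_power fs n * Fs ! j"
    using assms unfolding MinSP_def by blast
  then have "Fs ! i \<in> set Fs" "Fs ! j \<in> set Fs"
    by simp_all
  then show ?thesis
    unfolding F
    by (intro diff_in_module_gen mult_in_module_gen lex_power_in_subalgebra_gen
        generator_in_module_gen) simp_all
qed

text \<open>A common element that is not minimal has another common element below it for the order
  of \<open>S\<close>. As \<open>S\<close> consists of natural numbers, the latter is smaller as a
  number too, so the descent ends; closure under addition collects the differences.\<close>

lemma min_common_below: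
  assumes S: "0 \<in> S" "\<And>m n. m \<in> S \<Longrightarrow> n \<in> S \<Longrightarrow> m + n \<in> S"
    and D: "D \<in> (+) a ` S \<inter> (+) b ` S"
  shows "\<exists>c\<in>min_common S a b. \<exists>s\<in>S. D = c + s"
  using D
proof (induction D rule: less_induct)
  case (less D)
  show ?case
  proof (cases "D \<in> min_common S a b")
    case True
    then show ?thesis using S(1) by force
  next
    case False
    then obtain c s where c: "c \<in> (+) a ` S \<inter> (+) b ` S" "c \<noteq> D" "s \<in> S" "int D - int c = int s"
      using less.prems unfolding min_common_def le_semigroup_def by blast
    then have Dcs: "D = c + s" by linarith
    with c(2) have "c < D" by simp
    from less.IH[OF this c(1)] obtain c' s' where "c' \<in> min_common S a b" "s' \<in> S" "c = c' + s'"
      by blast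
    moreover have "D = c' + (s' + s)"
      using Dcs \<open>c = c' + s'\<close> by simp
    ultimately show ?thesis
      using S(2) c(3) by blast
  qed
qed

section \<open>The criterion for bases of submodules\<close>

text \<open>The leading terms cancel. The difference must be nonzero because the zero polynomial has
  degree 0, which is not below \<open>n = 0\<close>.\<close>

lemma degree_diff_less_of_lead_coeff_eq:
  fixes p q :: "'a::field poly"
  assumes "degree p = n" "degree q = n" "lead_coeff p = lead_coeff q" "p - q \<noteq> 0"
  shows "degree (p - q) < n"
proof -
  have "degree (p - q) \<le> n"
    using assms by (simp add: degree_diff_le)
  moreover have "coeff (p - q) n = 0"
    using assms by simp
  ultimately show ?thesis
    using assms(4) by (metis le_neq_implies_less leading_coeff_0_iff)
qed

text \<open>Below \<open>D\<close> there is a minimal common element \<open>c\<close>, with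
  \<open>D = c + s\<close>. The minimal S-polynomial at \<open>c\<close> has remainder 0, hence a
  representation with terms of degree below \<open>c\<close>; multiplying by a monic element of
  \<open>A\<close> of degree \<open>s\<close> lifts everything to \<open>D\<close>.\<close>

lemma S_polynomial_representation:
  fixes fs Gs :: "'a::field poly list"
  defines "A \<equiv> subalgebra_gen (set fs)"
  assumes rb: "reduced_basis A fs"
    and rem: "remainder_choice A rem"
    and monic: "\<forall>G\<in>set Gs. lead_coeff G = 1"
    and ret: "procedure_returns rem fs Gs"
    and G: "G1 \<in> set Gs" "G2 \<in> set Gs" "G1 \<noteq> G2"
    and D: "D \<in> (+) (degree G1) ` degs A \<inter> (+) (degree G2) ` degs A"
  obtains p q h where "p \<in> A" "q \<in> A" "lead_coeff p = 1" "lead_coeff q = 1"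
    "degree p + degree G1 = D" "degree q + degree G2 = D"
    "\<forall>G\<in>set Gs. h G \<in> A" "p * G1 - q * G2 = (\<Sum>G\<in>set Gs. h G * G)"
    "\<forall>G\<in>set Gs. h G \<noteq> 0 \<longrightarrow> degree (h G) + degree G < D"
proof -
  have S: "submonoid_gen (degree ` set fs) = degs A"
    and fm: "\<forall>f\<in>set fs. lead_coeff f = 1"
    using rb by (auto simp: reduced_basis_def algebra_basis_def)
  obtain c s where c: "c \<in> min_common (degs A) (degree G1) (degree G2)" and s: "s \<in> degs A"
    and Dcs: "D = c + s"
    using min_common_below[OF _ _ D] zero_in_degs add_in_degs unfolding A_def by blast
  obtain m n where m: "m \<in> degs A" "c = degree G1 + m" and n: "n \<in> degs A" "c = degree G2 + n"
    using c by (auto simp: min_common_def)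
  have mn: "(m, n) \<in> R_set (degs A) (degree G1) (degree G2)"
  proof -
    have "m = c - degree G1" "n = c - degree G2"
      using m n by simp_all
    then show ?thesis
      using c unfolding R_set_def by blast
  qed
  obtain a where a: "a \<in> A" "lead_coeff a = 1" "degree a = s"
    using monic_of_degree s unfolding A_def by blast
  have a0: "a \<noteq> 0"
    using a by auto
  define P where "P = lex_power fs m"
  define Q where "Q = lex_power fs n"
  have PQ: "P \<in> A" "Q \<in> A" "lead_coeff P = 1" "lead_coeff Q = 1" "degree P = m" "degree Q = n"
    using lex_power_in_subalgebra_gen lead_coeff_lex_power[OF fm] degree_lex_power[OF fm] m(1) n(1) S
    unfolding P_def Q_def A_def by blast+
  have nz: "P \<noteq> 0" "Q \<noteq> 0" "G1 \<noteq> 0" "G2 \<noteq> 0"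
    using PQ monic G by auto
  define F where "F = P * G1 - Q * G2"
  \<comment> \<open>Distinct polynomials sit at distinct positions of the list, as
    \<open>MinSP\<close> demands.\<close>
  obtain i j where "i < length Gs" "Gs ! i = G1" "j < length Gs" "Gs ! j = G2"
    using G by (auto simp: in_set_conv_nth)
  then have "F \<in> MinSP fs Gs"
    using G mn unfolding MinSP_def F_def P_def Q_def A_def by blast
  then have rF: "rem F (set Gs) = 0"
    using ret by (simp add: procedure_returns_def)
  have "\<exists>h. (\<forall>G\<in>set Gs. h G \<in> A) \<and> F = (\<Sum>G\<in>set Gs. h G * G) \<and>
      (\<forall>G\<in>set Gs. h G \<noteq> 0 \<longrightarrow> degree (h G) + degree G < c)"
  proof (cases "F = 0")
    case True
    then show ?thesis
      using zero_in_subalgebra_gen[of "set fs"] by (intro exI[of _ "\<lambda>_. 0"]) (simp add: A_def)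
  next
    case False
    have "set Gs \<noteq> {}"
      using G by auto
    then have "is_remainder A F (set Gs) 0"
      using rem False rF monic by (metis List.finite_set remainder_choice_def)
    then obtain h where h: "\<forall>G\<in>set Gs. h G \<in> A" "F = (\<Sum>G\<in>set Gs. h G * G)"
      "\<forall>G\<in>set Gs. h G \<noteq> 0 \<longrightarrow> degree (h G) + degree G \<le> degree F"
      by (auto simp: is_remainder_def)
    \<comment> \<open>Both products are monic of degree \<open>c\<close>, so their difference drops
      below \<open>c\<close>; this makes the bound by \<open>degree F\<close> a strict bound by
      \<open>c\<close>.\<close>
    have "lead_coeff (P * G1) = lead_coeff (Q * G2)"
      unfolding lead_coeff_mult using PQ monic G by simp
    moreover have "degree (P * G1) = c" "degree (Q * G2) = c"
      using nz PQ m n by (simp_all add: degree_mult_eq)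
    ultimately have "degree F < c"
      unfolding F_def using degree_diff_less_of_lead_coeff_eq False F_def by blast
    then show ?thesis
      using h by (intro exI[of _ h]) (auto intro: le_less_trans)
  qed
  then obtain h where h: "\<forall>G\<in>set Gs. h G \<in> A" "F = (\<Sum>G\<in>set Gs. h G * G)"
      "\<forall>G\<in>set Gs. h G \<noteq> 0 \<longrightarrow> degree (h G) + degree G < c"
    by blast
  show thesis
  proof (rule that[of "a * P" "a * Q" "\<lambda>G. a * h G"])
    show "a * P \<in> A" "a * Q \<in> A" "\<forall>G\<in>set Gs. a * h G \<in> A"
      using a PQ h unfolding A_def by (auto intro: subalgebra_gen.mult)
    show "lead_coeff (a * P) = 1" "lead_coeff (a * Q) = 1"
      using a PQ by (simp_all add: lead_coeff_mult)
    show "degree (a * P) + degree G1 = D" "degree (a * Q) + degree G2 = D"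
      using a a0 nz PQ m n Dcs by (simp_all add: degree_mult_eq)
    have "a * P * G1 - a * Q * G2 = a * F"
      by (simp add: F_def algebra_simps)
    then show "a * P * G1 - a * Q * G2 = (\<Sum>G\<in>set Gs. a * h G * G)"
      by (simp add: h(2) sum_distrib_left mult.assoc)
    show "\<forall>G\<in>set Gs. a * h G \<noteq> 0 \<longrightarrow> degree (a * h G) + degree G < D"
      using h(3) a a0 Dcs by (auto simp: degree_mult_eq)
  qed
qed

text \<open>Only a term that attains the bound \<open>D\<close> contributes to the coefficient at
  \<open>D\<close>, and since \<open>G\<close> is monic it contributes the leading coefficient of
  \<open>g\<close>.\<close>

lemma coeff_term_eq:
  fixes g G :: "'a::field poly"
  assumes "lead_coeff G = 1" "g \<noteq> 0 \<longrightarrow> degree g + degree G \<le> D"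
  shows "coeff (g * G) D = (if g \<noteq> 0 \<and> degree g + degree G = D then lead_coeff g else 0)"
proof (cases "g = 0")
  case False
  have "G \<noteq> 0"
    using assms(1) by auto
  with False have d: "degree (g * G) = degree g + degree G"
    by (simp add: degree_mult_eq)
  show ?thesis
  proof (cases "degree g + degree G = D")
    case True
    then have "coeff (g * G) D = lead_coeff (g * G)"
      using d by simp
    then show ?thesis
      using True False assms(1) by (simp add: lead_coeff_mult)
  next
    case False
    then show ?thesis
      using assms(2) \<open>g \<noteq> 0\<close> d by (auto intro: coeff_eq_0)
  qed
qed simp

text \<open>Replaces a degree bound with an exception for zero by linear conditions on coefficients,
  which pass directly to sums and scalar multiples.\<close>

lemma term_bound_iff:
  fixes g G :: "'a::field poly"
  shows "(g \<noteq> 0 \<longrightarrow> degree g + degree G < N) \<longleftrightarrow> (\<forall>k. k + degree G \<ge> N \<longrightarrow> coeff g k = 0)"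
    (is "?L \<longleftrightarrow> ?R")
proof
  assume ?L
  show ?R
  proof (intro allI impI)
    fix k assume "N \<le> k + degree G"
    with \<open>?L\<close> have "g = 0 \<or> degree g < k"
      by linarith
    then show "coeff g k = 0"
      by (auto intro: coeff_eq_0)
  qed
next
  assume ?R
  show ?L
  proof (rule impI, rule ccontr)
    assume "g \<noteq> 0" "\<not> degree g + degree G < N"
    with \<open>?R\<close> have "lead_coeff g = 0"
      by simp
    with \<open>g \<noteq> 0\<close> show False
      by simp
  qed
qed

text \<open>The outer induction is on the strict bound \<open>N\<close>: at 0 all coefficients
  vanish, contrary to \<open>H \<noteq> 0\<close>. The inner induction is on the number of terms
  that attain the largest permitted degree.\<close>

lemma degree_in_union:
  fixes fs Gs :: "'a::field poly list"
  defines "A \<equiv> subalgebra_gen (set fs)"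
  assumes rb: "reduced_basis A fs"
    and rem: "remainder_choice A rem"
    and monic: "\<forall>G\<in>set Gs. lead_coeff G = 1"
    and ret: "procedure_returns rem fs Gs"
    and "H \<noteq> 0"
    and "\<forall>G\<in>set Gs. g G \<in> A" "H = (\<Sum>G\<in>set Gs. g G * G)"
    and "\<forall>G\<in>set Gs. g G \<noteq> 0 \<longrightarrow> degree (g G) + degree G < N"
  shows "degree H \<in> (\<Union>G\<in>set Gs. (+) (degree G) ` degs A)"
  using assms(7-)
proof (induction N arbitrary: g)
  case 0
  then have "H = 0"
    by auto
  with \<open>H \<noteq> 0\<close> show ?case by simp
next
  case (Suc D)
  \<comment> \<open>The generators whose terms attain degree \<open>D\<close>; the cardinality of
    this set is the inner induction measure.\<close>
  define J where "J g = {G \<in> set Gs. g G \<noteq> 0 \<and> degree (g G) + degree G = D}"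
    for g :: "'a poly \<Rightarrow> 'a poly"
  have finJ: "finite (J g)" for g
    by (simp add: J_def)
  from Suc.prems show ?case
  proof (induction "card (J g)" arbitrary: g rule: less_induct)
    case (less g)
    have bound: "\<forall>G\<in>set Gs. g G \<noteq> 0 \<longrightarrow> degree (g G) + degree G \<le> D"
      using less.prems(3) by auto
    have deg_in: "D \<in> (+) (degree G) ` degs A" if "G \<in> J g" for G
      using that less.prems(1) by (force simp: J_def degs_def)
    show ?case
    proof (cases "J g = {}")
      case True
      then have "\<forall>G\<in>set Gs. g G \<noteq> 0 \<longrightarrow> degree (g G) + degree G < D"
        using bound by (auto simp: J_def le_less)
      then show ?thesis
        using Suc.IH less.prems by blast
    next
      case False
      then obtain G1 where G1: "G1 \<in> J g"
        by blast
      show ?thesis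
      proof (cases "degree H = D")
        case True
        then show ?thesis
          using deg_in[OF G1] G1 by (auto simp: J_def)
      next
        case False
        have "coeff H D = (\<Sum>G\<in>set Gs. if g G \<noteq> 0 \<and> degree (g G) + degree G = D
            then lead_coeff (g G) else 0)"
          unfolding less.prems(2) coeff_sum
          using monic bound by (intro sum.cong coeff_term_eq) auto
        also have "\<dots> = (\<Sum>G\<in>J g. lead_coeff (g G))"
          unfolding J_def by (rule sum.inter_filter[symmetric]) simp
        finally have cH: "coeff H D = (\<Sum>G\<in>J g. lead_coeff (g G))" .
        have "degree H \<le> D"
          unfolding less.prems(2)
        proof (rule degree_sum_le)
          fix G assume "G \<in> set Gs"
          then show "degree (g G * G) \<le> D"
            using bound degree_mult_le[of "g G" G] by (cases "g G = 0") force+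
        qed simp
        with False have "coeff H D = 0"
          by (simp add: coeff_eq_0)
        with cH have sum0: "(\<Sum>G\<in>J g. lead_coeff (g G)) = 0"
          by simp
        \<comment> \<open>A single nonzero leading coefficient cannot sum to 0, so a second term of
          degree \<open>D\<close> exists.\<close>
        have "J g \<noteq> {G1}"
        proof
          assume "J g = {G1}"
          then have "lead_coeff (g G1) = 0"
            using sum0 by simp
          then show False
            using G1 by (simp add: J_def)
        qed
        then obtain G2 where G2: "G2 \<in> J g" "G1 \<noteq> G2"
          using G1 by blast
        have mem: "G1 \<in> set Gs" "G2 \<in> set Gs"
          using G1 G2 by (auto simp: J_def)
        have "D \<in> (+) (degree G1) ` degs A \<inter> (+) (degree G2) ` degs A"
          using deg_in G1 G2 by blast
        then obtain p q h where p: "p \<in> A" and q: "q \<in> A"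
          and lp: "lead_coeff p = 1" and "lead_coeff q = 1"
          and dp: "degree p + degree G1 = D" and dq: "degree q + degree G2 = D"
          and h: "\<forall>G\<in>set Gs. h G \<in> A" "p * G1 - q * G2 = (\<Sum>G\<in>set Gs. h G * G)"
            "\<forall>G\<in>set Gs. h G \<noteq> 0 \<longrightarrow> degree (h G) + degree G < D"
          unfolding A_def
          by (rule S_polynomial_representation[OF rb[unfolded A_def] rem[unfolded A_def] monic ret
              mem G2(2)])
        define c where "c = lead_coeff (g G1)"
        \<comment> \<open>Adds \<open>c\<close> times the relation
          \<open>(\<Sum>G\<in>set Gs. h G * G) - p * G1 + q * G2 = 0\<close>. The value
          \<open>H\<close> is unchanged, the leading term of \<open>g G1\<close> is cancelled, and
          the other degree-\<open>D\<close> contribution falls on \<open>G2\<close>, which already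
          belongs to \<open>J g\<close>.\<close>
        define g' where "g' G = g G + smult c (h G) -
            (if G = G1 then smult c p else 0) + (if G = G2 then smult c q else 0)" for G
        have g'A: "\<forall>G\<in>set Gs. g' G \<in> A"
          using less.prems(1) h(1) p q unfolding g'_def A_def
          by (auto intro!: subalgebra_gen.add diff_in_subalgebra_gen smult_in_subalgebra_gen
              zero_in_subalgebra_gen)
        have "(\<Sum>G\<in>set Gs. g' G * G) = (\<Sum>G\<in>set Gs. g G * G + smult c (h G * G) -
            (if G = G1 then smult c p * G1 else 0) + (if G = G2 then smult c q * G2 else 0))"
          by (rule sum.cong) (auto simp: g'_def algebra_simps)
        also have "\<dots> = H + smult c (\<Sum>G\<in>set Gs. h G * G) - smult c (p * G1) + smult c (q * G2)"
          using mem sum_distrib_left[of "[:c:]" "\<lambda>G. h G * G" "set Gs"]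
          by (simp add: sum.distrib sum_subtractf less.prems(2))
        also have "\<dots> = H"
          unfolding h(2)[symmetric] by (simp add: smult_diff_right)
        finally have g'H: "H = (\<Sum>G\<in>set Gs. g' G * G)"
          by simp
        have g0: "coeff (g G) k = 0" if "G \<in> set Gs" "k + degree G > D" for G k
          using less.prems(3) that term_bound_iff[of "g G" G "Suc D"] by auto
        have g0': "coeff (g G) k = 0" if "G \<in> set Gs" "G \<notin> J g" "k + degree G \<ge> D" for G k
          using bound that term_bound_iff[of "g G" G D] by (auto simp: J_def le_less)
        have h0: "coeff (h G) k = 0" if "G \<in> set Gs" "k + degree G \<ge> D" for G k
          using h(3) that term_bound_iff[of "h G" G D] by auto
        have p0: "coeff p k = 0" if "k + degree G1 > D" for k
          using that dp by (intro coeff_eq_0) simp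
        have q0: "coeff q k = 0" if "k + degree G2 > D" for k
          using that dq by (intro coeff_eq_0) simp
        have bound': "\<forall>G\<in>set Gs. g' G \<noteq> 0 \<longrightarrow> degree (g' G) + degree G < Suc D"
          unfolding term_bound_iff by (auto simp: g'_def g0 h0 p0 q0)
        \<comment> \<open>In degree \<open>D - degree G1\<close> both \<open>g G1\<close> and
          \<open>smult c p\<close> have coefficient \<open>c\<close>; above it both vanish.\<close>
        have G1': "coeff (g' G1) k = 0" if "k + degree G1 \<ge> D" for k
        proof (cases "k + degree G1 = D")
          case True
          have "degree (g G1) + degree G1 = D"
            using G1 by (simp add: J_def)
          then have "k = degree (g G1)" "k = degree p"
            using True dp by simp_all
          then have "coeff (g G1) k = c" "coeff p k = 1"
            using lp by (simp_all only: c_def)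
          then show ?thesis
            using G2 mem h0 that by (simp add: g'_def)
        next
          case False
          then show ?thesis
            using G2 mem h0 g0 p0 that by (simp add: g'_def)
        qed
        \<comment> \<open>Outside \<open>J g\<close> only a multiple of \<open>h G\<close> is added,
          whose term stays below \<open>D\<close>, so no new term attains \<open>D\<close>.\<close>
        have "G \<notin> J g'" if "G \<in> set Gs" "G \<notin> J g \<or> G = G1" for G
        proof -
          have "\<forall>k. k + degree G \<ge> D \<longrightarrow> coeff (g' G) k = 0"
          proof (cases "G = G1")
            case True
            then show ?thesis using G1' by blast
          next
            case False
            then have "G \<notin> J g" "G \<noteq> G2"
              using that G2 by auto
            then show ?thesis
              using False that g0' h0 by (simp add: g'_def)
          qed
          then have "g' G \<noteq> 0 \<longrightarrow> degree (g' G) + degree G < D"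
            unfolding term_bound_iff .
          then show ?thesis
            by (auto simp: J_def)
        qed
        then have "J g' \<subset> J g"
          using G1 mem unfolding J_def by blast
        then have "card (J g') < card (J g)"
          using finJ by (intro psubset_card_mono)
        from less.hyps[OF this g'A g'H bound'] show ?thesis .
      qed
    qed
  qed
qed

section \<open>Termination and correctness\<close>

text \<open>By the pigeonhole principle infinitely many values share a residue modulo
  \<open>s\<close>. From the least of them, any later one differs by a nonnegative multiple of
  \<open>s\<close>, which lies in the semigroup.\<close>

lemma no_infinite_antichain:
  fixes d :: "nat \<Rightarrow> nat"
  assumes s: "s \<in> degs (subalgebra_gen X)" "s > 0"
  shows "\<exists>m n. m < n \<and> d n \<in> (+) (d m) ` degs (subalgebra_gen X)"
proof (rule ccontr)
  assume no: "\<not> ?thesis"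
  have "range (\<lambda>n. d n mod s) \<subseteq> {..<s}"
    using s by auto
  then have "finite (range (\<lambda>n. d n mod s))"
    by (rule finite_subset) simp
  then obtain n0 where inf: "infinite {n. d n mod s = d n0 mod s}"
    using pigeonhole_infinite[of UNIV "\<lambda>n. d n mod s"] by auto
  define I where "I = {n. d n mod s = d n0 mod s}"
  have "n0 \<in> I"
    by (simp add: I_def)
  then obtain m where m: "m \<in> I" "\<And>n. n \<in> I \<Longrightarrow> d m \<le> d n"
    using exists_least_iff[of "\<lambda>k. \<exists>n\<in>I. d n = k"] by (metis not_le)
  \<comment> \<open>The index of the least value need not be the first in \<open>I\<close>;
    infinitude provides an index after it.\<close>
  have "\<not> I \<subseteq> {..m}"
    using inf finite_subset[OF _ finite_atMost[of m]] unfolding I_def by blast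
  then obtain n where n: "n \<in> I" "m < n"
    by (meson atMost_iff not_le subsetI)
  have "s dvd d n - d m"
    using m(1) n(1) mod_eq_dvd_iff_nat[OF m(2)[OF n(1)], of s] by (simp add: I_def)
  then obtain k where "d n - d m = k * s"
    by (metis dvd_def mult.commute)
  then have "d n = d m + k * s"
    using m(2)[OF n(1)] by simp
  then have "d n \<in> (+) (d m) ` degs (subalgebra_gen X)"
    using mult_in_degs[OF s(1)] by blast
  with no n(2) show False
    by blast
qed

text \<open>The invariant of the procedure. It includes the nonemptiness and monicity under which
  \<open>remainder_choice\<close> constrains \<open>rem\<close>.\<close>

definition procedure_state :: "'a::field poly set \<Rightarrow> 'a poly set \<Rightarrow> 'a poly list \<Rightarrow> bool" where
  "procedure_state A M Gs \<longleftrightarrow>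
     Gs \<noteq> [] \<and> (\<forall>G\<in>set Gs. lead_coeff G = 1) \<and> module_gen A (set Gs) = M"

text \<open>The new polynomial is a nonzero scalar multiple of a remainder: it lies in the module,
  and its degree avoids the union by the defining property of remainders.\<close>

lemma procedure_step_state:
  fixes fs :: "'a::field poly list"
  defines "A \<equiv> subalgebra_gen (set fs)"
  assumes rem: "remainder_choice A rem"
    and Gs: "procedure_state A M Gs"
    and step: "procedure_step rem fs Gs Hs"
  obtains G where "Hs = Gs @ [G]" "degree G \<notin> (\<Union>G\<in>set Gs. (+) (degree G) ` degs A)"
    "procedure_state A M Hs"
proof -
  obtain F where F: "F \<in> MinSP fs Gs" "rem F (set Gs) \<noteq> 0" and
    Hs: "Hs = Gs @ [smult (inverse (lead_coeff (rem F (set Gs)))) (rem F (set Gs))]"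
    using step by (auto elim: procedure_step.cases)
  define R where "R = rem F (set Gs)"
  define G where "G = smult (inverse (lead_coeff R)) R"
  have R0: "R \<noteq> 0"
    using F by (simp add: R_def)
  have Gs': "finite (set Gs)" "set Gs \<noteq> {}" "\<forall>G\<in>set Gs. lead_coeff G = 1"
    using Gs by (simp_all add: procedure_state_def)
  \<comment> \<open>The chosen remainder of 0 is 0.\<close>
  then have "F \<noteq> 0"
    using rem F(2) unfolding remainder_choice_def by blast
  then have R: "is_remainder A F (set Gs) R"
    using rem Gs' unfolding remainder_choice_def R_def by blast
  have HG: "Hs = Gs @ [G]"
    using Hs by (simp add: G_def R_def)
  have "R \<in> module_gen A (set Gs)"
    using remainder_in_module_gen R MinSP_in_module_gen[OF F(1)] unfolding A_def by blast
  then have "G \<in> module_gen A (set Gs)"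
    using mult_in_module_gen[OF subalgebra_gen.const[of "inverse (lead_coeff R)"]]
    unfolding A_def G_def by fastforce
  then have "module_gen A (insert G (set Gs)) = module_gen A (set Gs)"
    using module_gen_insert Gs'(1) unfolding A_def by blast
  moreover have "lead_coeff G = 1"
    using R0 by (simp add: G_def)
  ultimately have "procedure_state A M Hs"
    using Gs by (simp add: procedure_state_def HG)
  moreover have "degree G \<notin> (\<Union>G\<in>set Gs. (+) (degree G) ` degs A)"
    using R R0 by (auto simp: is_remainder_def G_def)
  ultimately show thesis
    using that HG by blast
qed

text \<open>In an infinite run the degree of each added polynomial avoids the translates of the
  semigroup by all earlier degrees, contradicting \<open>no_infinite_antichain\<close>. Finite
  length supplies the positive \<open>s\<close>.\<close>

lemma procedure_terminates:
  fixes fs :: "'a::field poly list"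
  defines "A \<equiv> subalgebra_gen (set fs)"
  assumes fl: "quotient_finite_length A"
    and rem: "remainder_choice A rem"
    and start: "procedure_state A M (Gs 0)"
    and step: "\<And>n. procedure_step rem fs (Gs n) (Gs (Suc n))"
  shows False
proof -
  obtain s where s: "s \<in> degs A" "s > 0"
    using finite_length_imp_positive_degree fl unfolding A_def by blast
  have state: "procedure_state A M (Gs n)" for n
  proof (induction n)
    case (Suc n)
    from procedure_step_state[OF rem[unfolded A_def] this[unfolded A_def] step]
    show ?case
      unfolding A_def .
  qed (rule start)
  have "\<exists>G. Gs (Suc n) = Gs n @ [G] \<and>
      degree G \<notin> (\<Union>G\<in>set (Gs n). (+) (degree G) ` degs A)" for n
    using procedure_step_state[OF rem[unfolded A_def] state[unfolded A_def] step]
    unfolding A_def by blast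
  then obtain G where G: "\<And>n. Gs (Suc n) = Gs n @ [G n]"
    "\<And>n. degree (G n) \<notin> (\<Union>G\<in>set (Gs n). (+) (degree G) ` degs A)"
    by metis
  have mem: "G m \<in> set (Gs n)" if "m < n" for m n
    using that by (induction n) (auto simp: G(1) less_Suc_eq)
  obtain m n where "m < n" "degree (G n) \<in> (+) (degree (G m)) ` degs A"
    using no_infinite_antichain[of s "set fs" "\<lambda>n. degree (G n)"] s unfolding A_def by blast
  then show False
    using G(2)[of n] mem by blast
qed

lemma module_basis_if_returned:
  fixes fs Gs :: "'a::field poly list"
  defines "A \<equiv> subalgebra_gen (set fs)"
  assumes rb: "reduced_basis A fs"
    and rem: "remainder_choice A rem"
    and Gs: "procedure_state A M Gs"
    and ret: "procedure_returns rem fs Gs"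
  shows "module_basis A M (set Gs)"
proof -
  have monic: "\<forall>G\<in>set Gs. lead_coeff G = 1" and M: "module_gen A (set Gs) = M"
    using Gs by (simp_all add: procedure_state_def)
  have "degs M = (\<Union>G\<in>set Gs. (+) (degree G) ` degs A)"
  proof (intro equalityI subsetI)
    fix n assume "n \<in> degs M"
    then obtain H where H: "H \<in> M" "H \<noteq> 0" "n = degree H"
      by (auto simp: degs_def)
    then obtain g where g: "\<forall>G\<in>set Gs. g G \<in> A" "H = (\<Sum>G\<in>set Gs. g G * G)"
      unfolding M[symmetric] module_gen_def by blast
    \<comment> \<open>Any bound can start the induction of \<open>degree_in_union\<close>; the sum
      of all term degrees is a crude one, and \<open>Suc\<close> makes it strict.\<close>
    have "\<forall>G\<in>set Gs. g G \<noteq> 0 \<longrightarrow>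
        degree (g G) + degree G < Suc (\<Sum>G\<in>set Gs. degree (g G) + degree G)"
      using member_le_sum[of _ "set Gs" "\<lambda>G. degree (g G) + degree G"] by (auto simp: less_Suc_eq_le)
    then show "n \<in> (\<Union>G\<in>set Gs. (+) (degree G) ` degs A)"
      using degree_in_union[OF rb[unfolded A_def] rem[unfolded A_def] monic ret H(2)
          g[unfolded A_def]] H(3) unfolding A_def by blast
  next
    fix n assume "n \<in> (\<Union>G\<in>set Gs. (+) (degree G) ` degs A)"
    then obtain G a where Ga: "G \<in> set Gs" "a \<in> A" "a \<noteq> 0" "n = degree G + degree a"
      by (auto simp: degs_def)
    have "G \<noteq> 0"
      using monic Ga(1) by auto
    moreover have "a * G \<in> M"
      using mult_in_module_gen generator_in_module_gen Ga M unfolding A_def by blast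
    ultimately show "n \<in> degs M"
      using Ga unfolding degs_def
      by (intro image_eqI[of _ _ "a * G"]) (auto simp: degree_mult_eq)
  qed
  then show ?thesis
    using monic M by (auto simp: module_basis_def)
qed

theorem mainTheorem2:
  fixes fs Fs :: "'a::field poly list"
    and A M :: "'a poly set"
    and rem :: "'a poly \<Rightarrow> 'a poly set \<Rightarrow> 'a poly"
  assumes "A = subalgebra_gen (set fs)"
    and "quotient_finite_length A"
    and "reduced_basis A fs"
    and "M = module_gen A (set Fs)"
    and "length Fs \<ge> 1"
    and "\<forall>F\<in>set Fs. lead_coeff F = 1"
    and "remainder_choice A rem"
  shows "\<not> (\<exists>Gs. Gs 0 = Fs \<and> (\<forall>n. procedure_step rem fs (Gs n) (Gs (Suc n)))) \<and>
         (\<forall>Gs. (procedure_step rem fs)\<^sup>*\<^sup>* Fs Gs \<and> procedure_returns rem fs Gs \<longrightarrow>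
               module_basis A M (set Gs))"
proof (intro conjI allI impI notI)
  have start: "procedure_state A M Fs"
    using assms by (auto simp: procedure_state_def)
  \<comment> \<open>A list admits no step exactly when \<open>procedure_returns\<close> holds, so
    excluding infinite runs means that every run reaches a returned list.\<close>
  show False if "\<exists>Gs. Gs 0 = Fs \<and> (\<forall>n. procedure_step rem fs (Gs n) (Gs (Suc n)))"
  proof -
    from that obtain Gs where "Gs 0 = Fs" "\<And>n. procedure_step rem fs (Gs n) (Gs (Suc n))"
      by blast
    then show False
      using procedure_terminates[of fs rem M Gs] start assms by simp
  qed
  fix Gs assume Gs: "(procedure_step rem fs)\<^sup>*\<^sup>* Fs Gs \<and> procedure_returns rem fs Gs"
  then have "(procedure_step rem fs)\<^sup>*\<^sup>* Fs Gs"
    by blast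
  \<comment> \<open>The invariant is carried along the finite run from \<open>Fs\<close> to
    \<open>Gs\<close>.\<close>
  then have "procedure_state A M Gs"
  proof induction
    case (step Hs Hs')
    from procedure_step_state[OF assms(7)[unfolded assms(1)] step(3)[unfolded assms(1)] step(2)]
    show ?case
      unfolding assms(1) .
  qed (rule start)
  then show "module_basis A M (set Gs)"
    using module_basis_if_returned[of fs rem M Gs] Gs assms by blast
qed

end
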